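(* Let $G$ be a unicyclic graph of order $n$. Then $$\sqrt{2}\,n\leq HSO(G)\leq (n-3)\sqrt{n^2-2n+2}+\sqrt{n^2-2n+5}+\sqrt{2},$$ with equality on the left if and only if $G\cong C_n$ and equality on the right if and only if $G\cong S'_n$.
   Context: All graphs are finite, simple and connected. For a graph $G$ with edge set $E(G)$, $d_i$ denotes the degree of the vertex $v_i$, and the Hyperbolic Sombor index is $HSO(G)=\sum_{v_iv_j\in E(G)}\frac{\sqrt{d_i^2+d_j^2}}{\min\{d_i,d_j\}}$. A unicyclic graph of order $n$ is a connected graph with $n$ vertices and $n$ edges. $C_n$ denotes the cycle on $n$ vertices. $S'_n$ denotes the unicyclic graph of order $n$ obtained from a triangle $C_3$ by attaching $n-3$ pendent vertices (vertices of degree one) to one single vertex of the triangle. *)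

theory Defs
  imports Complex_Main
begin

text \<open>Edges are two-element sets of vertices.\<close>

record 'a ugraph =
  verts :: "'a set"
  edges :: "'a set set"

definition simple_graph :: "'a ugraph \<Rightarrow> bool" where
  "simple_graph G \<longleftrightarrow> finite (verts G) \<and> (\<forall>e \<in> edges G. e \<subseteq> verts G \<and> card e = 2)"

definition adj_rel :: "'a ugraph \<Rightarrow> ('a \<times> 'a) set" where
  "adj_rel G = {(u, v). {u, v} \<in> edges G}"

text \<open>The graph without vertices does not count as connected.\<close>

definition connected_graph :: "'a ugraph \<Rightarrow> bool" where
  "connected_graph G \<longleftrightarrow>
     verts G \<noteq> {} \<and> (\<forall>u \<in> verts G. \<forall>v \<in> verts G. (u, v) \<in> (adj_rel G)\<^sup>*)"

definition degree :: "'a ugraph \<Rightarrow> 'a \<Rightarrow> nat" where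
  "degree G v = card {e \<in> edges G. v \<in> e}"

text \<open>Sum and minimum over the two ends of \<open>e\<close> avoid choosing an order on them;
  see \<open>HSO_weight_pair\<close>.\<close>

definition HSO_weight :: "'a ugraph \<Rightarrow> 'a set \<Rightarrow> real" where
  "HSO_weight G e = sqrt (\<Sum>v\<in>e. (real (degree G v))\<^sup>2) / real (Min (degree G ` e))"

definition HSO :: "'a ugraph \<Rightarrow> real" where
  "HSO G = (\<Sum>e \<in> edges G. HSO_weight G e)"

lemma HSO_weight_pair:
  assumes "u \<noteq> v"
  shows "HSO_weight G {u, v} =
    sqrt ((real (degree G u))\<^sup>2 + (real (degree G v))\<^sup>2) / real (min (degree G u) (degree G v))"
  using assms by (simp add: HSO_weight_def)

definition unicyclic :: "'a ugraph \<Rightarrow> nat \<Rightarrow> bool" where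
  "unicyclic G n \<longleftrightarrow>
     simple_graph G \<and> connected_graph G \<and> card (verts G) = n \<and> card (edges G) = n"

definition graph_iso :: "'a ugraph \<Rightarrow> 'b ugraph \<Rightarrow> bool" (infix "\<cong>\<^sub>G" 50) where
  "G \<cong>\<^sub>G H \<longleftrightarrow> (\<exists>f. bij_betw f (verts G) (verts H) \<and>
     (\<forall>u \<in> verts G. \<forall>v \<in> verts G. {u, v} \<in> edges G \<longleftrightarrow> {f u, f v} \<in> edges H))"

text \<open>The next two graphs are the intended ones only for \<open>n \<ge> 3\<close>, which holds for the
  order of any unicyclic graph.\<close>

definition cycle_graph :: "nat \<Rightarrow> nat ugraph" where
  "cycle_graph n = \<lparr> verts = {..<n}, edges = {{i, (i + 1) mod n} | i. i < n} \<rparr>"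

text \<open>Triangle on \<open>0, 1, 2\<close>, with the pendent vertices \<open>3, \<dots>, n - 1\<close> attached to \<open>0\<close>.\<close>

definition S'_graph :: "nat \<Rightarrow> nat ugraph" where
  "S'_graph n = \<lparr> verts = {..<n},
     edges = {{0, 1}, {1, 2}, {0, 2}} \<union> {{0, i} | i. 3 \<le> i \<and> i < n} \<rparr>"

end

theory Submission
  imports Defs
begin

text \<open>
  Write \<open>f x = sqrt (1 + x\<^sup>2)\<close>. An edge whose ends have degrees \<open>a \<le> b\<close> has weight \<open>f (b / a)\<close>, so
  the weight depends only on how unequal the two degrees are.

  Lower bound: every weight is at least \<open>f 1 = sqrt 2\<close>, and there are \<open>n\<close> edges. Equality forces
  equal degrees along every edge, hence a regular graph by connectedness; the degrees sum to
  \<open>2 * n\<close>, so all of them are 2, and a connected 2-regular graph is a cycle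
  (\<open>connected_two_regular_is_cycle\<close>).

  Upper bound: everything depends on whether some vertex has degree \<open>n - 1\<close>. If so, the edges at
  that vertex are all but one of the \<open>n\<close> edges, and wherever the last one lies the graph is
  \<open>S'_graph n\<close> (\<open>dominating_vertex_is_S'\<close>), whose index is the bound itself. If not, all degrees are
  at most \<open>n - 2\<close>, so a weight is at most \<open>f (n - 2)\<close>, and at most \<open>f ((n - 2) / 2)\<close> on an edge
  without pendent end. At least three edges are of the second kind, as the cycle would show; a
  double count gives this without constructing a cycle (\<open>three_non_pendent_edges\<close>). Therefore
  \<open>HSO G \<le> (n - 3) * f (n - 2) + 3 * f ((n - 2) / 2)\<close>, which lies strictly below the claimed bound
  \<open>(n - 3) * f (n - 1) + 2 * f ((n - 1) / 2) + sqrt 2\<close> (\<open>sqrt_gap\<close>). So equality can occur only in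
  the first case.
\<close>

section \<open>Neighbours, degrees and the handshake identity\<close>

definition nbrs :: "'a ugraph \<Rightarrow> 'a \<Rightarrow> 'a set" where
  "nbrs G v = {u. {v, u} \<in> edges G}"

lemma finite_edges: "simple_graph G \<Longrightarrow> finite (edges G)"
  by (rule finite_subset[of _ "Pow (verts G)"]) (auto simp: simple_graph_def)

lemma edgeE:
  assumes "simple_graph G" "e \<in> edges G"
  obtains u v where "e = {u, v}" "u \<noteq> v" "u \<in> verts G" "v \<in> verts G"
proof -
  have "card e = 2" "e \<subseteq> verts G" using assms by (auto simp: simple_graph_def)
  then show ?thesis using that by (auto simp: card_2_iff)
qed

lemma edge_ends:
  assumes "simple_graph G" "{u, v} \<in> edges G"
  shows "u \<noteq> v" "u \<in> verts G" "v \<in> verts G"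
proof -
  have "card {u, v} = 2" "{u, v} \<subseteq> verts G" using assms by (auto simp: simple_graph_def)
  then show "u \<noteq> v" "u \<in> verts G" "v \<in> verts G" by auto
qed

lemma incident_edges:
  assumes "simple_graph G"
  shows "{e \<in> edges G. v \<in> e} = (\<lambda>u. {v, u}) ` nbrs G v"
proof (intro equalityI subsetI)
  fix e assume "e \<in> {e \<in> edges G. v \<in> e}"
  then have e: "e \<in> edges G" "v \<in> e" by auto
  then obtain x y where "e = {x, y}" by (meson assms edgeE)
  then show "e \<in> (\<lambda>u. {v, u}) ` nbrs G v" using e by (auto simp: nbrs_def insert_commute)
qed (auto simp: nbrs_def)

lemma nbrs_subset: "simple_graph G \<Longrightarrow> nbrs G v \<subseteq> verts G - {v}"
  by (auto simp: nbrs_def dest: edge_ends)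

lemma finite_nbrs: "simple_graph G \<Longrightarrow> finite (nbrs G v)"
  using nbrs_subset by (metis finite_Diff finite_subset simple_graph_def)

lemma degree_eq_card_nbrs:
  assumes "simple_graph G"
  shows "degree G v = card (nbrs G v)"
proof -
  have "inj_on (\<lambda>u. {v, u}) (nbrs G v)" by (auto simp: inj_on_def doubleton_eq_iff)
  then show ?thesis unfolding degree_def incident_edges[OF assms] by (rule card_image)
qed

lemma degree_le:
  assumes "simple_graph G" "v \<in> verts G"
  shows "degree G v \<le> card (verts G) - 1"
proof -
  have "finite (verts G)" using assms by (simp add: simple_graph_def)
  then have "card (nbrs G v) \<le> card (verts G - {v})"
    by (intro card_mono nbrs_subset assms) simp
  then show ?thesis using assms by (simp add: degree_eq_card_nbrs)
qed

lemma degree_pos: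
  assumes "simple_graph G" "e \<in> edges G" "v \<in> e"
  shows "1 \<le> degree G v"
proof -
  have "finite {e \<in> edges G. v \<in> e}" using finite_edges[OF assms(1)] by simp
  then have "card {e \<in> edges G. v \<in> e} > 0" using assms by (auto simp: card_gt_0_iff)
  then show ?thesis by (simp add: degree_def)
qed

lemma handshake:
  assumes "simple_graph G"
  shows "(\<Sum>v\<in>verts G. degree G v) = 2 * card (edges G)"
proof -
  have "(\<Sum>v\<in>verts G. card {e \<in> edges G. v \<in> e}) = 2 * card (edges G)"
  proof (rule sum_multicount)
    show "\<forall>e\<in>edges G. card {v \<in> verts G. v \<in> e} = 2"
    proof
      fix e assume "e \<in> edges G"
      then have "card e = 2" "{v \<in> verts G. v \<in> e} = e"
        using assms by (auto simp: simple_graph_def)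
      then show "card {v \<in> verts G. v \<in> e} = 2" by simp
    qed
  qed (use assms finite_edges in \<open>auto simp: simple_graph_def\<close>)
  then show ?thesis by (simp add: degree_def)
qed

lemma connected_induct:
  assumes "connected_graph G" "u \<in> verts G" "v \<in> verts G" "P u"
    and "\<And>x y. P x \<Longrightarrow> {x, y} \<in> edges G \<Longrightarrow> P y"
  shows "P v"
proof -
  have "(u, v) \<in> (adj_rel G)\<^sup>*" using assms by (simp add: connected_graph_def)
  then show ?thesis
    by (induction rule: rtrancl_induct) (use assms in \<open>auto simp: adj_rel_def\<close>)
qed

section \<open>Isomorphisms\<close>

text \<open>Edges are sets of vertices, so a graph is transported along a bijection of the vertices by
  taking images twice; this traces an edge of the image back to the original graph.\<close>

lemma image_mem_image_iff:
  assumes "inj_on f A" "e \<subseteq> A" "\<forall>d\<in>E. d \<subseteq> A"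
  shows "f ` e \<in> (`) f ` E \<longleftrightarrow> e \<in> E"
proof
  assume "f ` e \<in> (`) f ` E"
  then obtain d where "d \<in> E" "f ` e = f ` d" by auto
  then show "e \<in> E" using assms inj_on_image_eq_iff by metis
qed auto

text \<open>This rule and the next trade the vertexwise condition of \<open>graph_iso\<close> for an equation between
  edge sets, which suits counting and summation. The rule takes the labelling \<open>w\<close> of \<open>G\<close> by the
  vertices of \<open>H\<close>, that is, the inverse of the isomorphism, because the model graphs have numbered
  vertices and it is a numbering of \<open>G\<close> that one constructs.\<close>

lemma graph_isoI:
  assumes H: "simple_graph H" and w: "bij_betw w (verts H) (verts G)"
    and E: "edges G = (`) w ` edges H"
  shows "G \<cong>\<^sub>G H"
  unfolding graph_iso_def
proof (intro exI conjI ballI)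
  let ?f = "inv_into (verts H) w"
  show f: "bij_betw ?f (verts G) (verts H)" by (rule bij_betw_inv_into[OF w])
  fix u v assume "u \<in> verts G" "v \<in> verts G"
  then have i: "?f u \<in> verts H" "?f v \<in> verts H" "w (?f u) = u" "w (?f v) = v"
    using f bij_betwE bij_betw_inv_into_right[OF w] by blast+
  have "w ` {?f u, ?f v} \<in> (`) w ` edges H \<longleftrightarrow> {?f u, ?f v} \<in> edges H"
    by (rule image_mem_image_iff[of _ "verts H"])
      (use H w i in \<open>auto simp: simple_graph_def bij_betw_def\<close>)
  then show "{u, v} \<in> edges G \<longleftrightarrow> {?f u, ?f v} \<in> edges H" using i E by simp
qed

lemma graph_isoE:
  assumes G: "simple_graph G" and H: "simple_graph H" and "G \<cong>\<^sub>G H"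
  obtains f where "bij_betw f (verts G) (verts H)" "edges H = (`) f ` edges G"
proof -
  obtain f where f: "bij_betw f (verts G) (verts H)"
    and e: "\<And>u v. u \<in> verts G \<Longrightarrow> v \<in> verts G \<Longrightarrow> {u, v} \<in> edges G \<longleftrightarrow> {f u, f v} \<in> edges H"
    using assms(3) by (auto simp: graph_iso_def)
  have "edges H = (`) f ` edges G"
  proof (intro equalityI subsetI)
    fix d assume d: "d \<in> edges H"
    then obtain x y where xy: "d = {x, y}" "x \<in> verts H" "y \<in> verts H" by (meson H edgeE)
    moreover have "verts H = f ` verts G" using f by (simp add: bij_betw_def)
    ultimately obtain u v where "u \<in> verts G" "v \<in> verts G" "x = f u" "y = f v"
      by blast
    then have "{u, v} \<in> edges G" "d = f ` {u, v}" using e xy d by auto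
    then show "d \<in> (`) f ` edges G" by blast
  next
    fix d assume "d \<in> (`) f ` edges G"
    then obtain c where c: "c \<in> edges G" "d = f ` c" by auto
    then obtain u v where "c = {u, v}" "u \<in> verts G" "v \<in> verts G" by (meson G edgeE)
    then show "d \<in> edges H" using e c by auto
  qed
  then show ?thesis using that f by blast
qed

lemma HSO_iso:
  assumes G: "simple_graph G" and H: "simple_graph H" and "G \<cong>\<^sub>G H"
  shows "HSO G = HSO H"
proof -
  obtain f where f: "bij_betw f (verts G) (verts H)" and E: "edges H = (`) f ` edges G"
    using graph_isoE[OF assms] .
  have inj: "inj_on f (verts G)" using f by (simp add: bij_betw_def)
  have sub: "\<And>e. e \<in> edges G \<Longrightarrow> e \<subseteq> verts G" using G by (auto simp: simple_graph_def)
  have inj2: "inj_on ((`) f) (edges G)"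
    using inj sub by (auto simp: inj_on_def inj_on_image_eq_iff)
  have deg: "degree H (f v) = degree G v" if v: "v \<in> verts G" for v
  proof -
    have "f v \<in> f ` e \<longleftrightarrow> v \<in> e" if "e \<in> edges G" for e
      using inj v sub[OF that] by (rule inj_on_image_mem_iff)
    then have "{e \<in> edges G. f v \<in> f ` e} = {e \<in> edges G. v \<in> e}" by blast
    moreover have "{d \<in> edges H. f v \<in> d} = (`) f ` {e \<in> edges G. f v \<in> f ` e}"
      unfolding E by blast
    ultimately have "{d \<in> edges H. f v \<in> d} = (`) f ` {e \<in> edges G. v \<in> e}" by simp
    moreover have "inj_on ((`) f) {e \<in> edges G. v \<in> e}"
      using inj2 by (rule inj_on_subset) auto
    ultimately show ?thesis by (simp add: degree_def card_image)
  qed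
  have wt: "HSO_weight H (f ` e) = HSO_weight G e" if "e \<in> edges G" for e
  proof -
    have "inj_on f e" using inj sub[OF that] by (rule inj_on_subset)
    then have "(\<Sum>v\<in>f ` e. (real (degree H v))\<^sup>2) = (\<Sum>v\<in>e. (real (degree G v))\<^sup>2)"
      using deg sub[OF that] by (auto simp: sum.reindex intro!: sum.cong)
    moreover have "degree H ` f ` e = degree G ` e"
      using deg sub[OF that] by (force simp: image_image)
    ultimately show ?thesis by (simp add: HSO_weight_def)
  qed
  show ?thesis unfolding HSO_def E using inj2 wt by (simp add: sum.reindex)
qed

section \<open>Bounds on the weight of an edge\<close>

lemma weight_eq:
  fixes a b :: nat
  assumes "1 \<le> a" "a \<le> b"
  shows "sqrt ((real a)\<^sup>2 + (real b)\<^sup>2) / real (min a b) = sqrt (1 + (real b / real a)\<^sup>2)"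
proof -
  have "sqrt (1 + (real b / real a)\<^sup>2) = sqrt (((real a)\<^sup>2 + (real b)\<^sup>2) / (real a)\<^sup>2)"
    using assms by (simp add: field_simps power_divide)
  then show ?thesis using assms by (simp add: real_sqrt_divide)
qed

text \<open>Orienting the edge from the end of smaller degree makes the weight an increasing function of
  the degree ratio; all bounds below are read off from this form.\<close>

lemma edge_weightE:
  assumes G: "simple_graph G" and e: "e \<in> edges G"
  obtains u v where "e = {u, v}" "1 \<le> degree G u" "degree G u \<le> degree G v"
    "HSO_weight G e = sqrt (1 + (real (degree G v) / real (degree G u))\<^sup>2)"
proof -
  obtain x y where xy: "e = {x, y}" "x \<noteq> y" by (meson G e edgeE)
  obtain u v where uv: "e = {u, v}" "u \<noteq> v" "degree G u \<le> degree G v"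
  proof (cases "degree G x \<le> degree G y")
    case True then show ?thesis using that xy by blast
  next
    case False
    then show ?thesis using that[of y x] xy by auto
  qed
  have "1 \<le> degree G u" using degree_pos[OF G e] uv by simp
  moreover have "HSO_weight G e = sqrt (1 + (real (degree G v) / real (degree G u))\<^sup>2)"
    using HSO_weight_pair[OF uv(2), of G] weight_eq[OF calculation uv(3)] uv(1) by simp
  ultimately show ?thesis using that uv by blast
qed

lemma edge_weight_ge:
  assumes "simple_graph G" "e \<in> edges G"
  shows "sqrt 2 \<le> HSO_weight G e"
proof -
  obtain u v where *: "1 \<le> degree G u" "degree G u \<le> degree G v"
    "HSO_weight G e = sqrt (1 + (real (degree G v) / real (degree G u))\<^sup>2)"
    using edge_weightE[OF assms] by metis
  then have "1 \<le> real (degree G v) / real (degree G u)" by simp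
  then have "1 \<le> (real (degree G v) / real (degree G u))\<^sup>2" by simp
  then show ?thesis using * by simp
qed

lemma edge_weight_eq_sqrt2:
  assumes "simple_graph G" "{x, y} \<in> edges G" "HSO_weight G {x, y} = sqrt 2"
  shows "degree G x = degree G y"
proof -
  obtain u v where *: "{x, y} = {u, v}" "1 \<le> degree G u" "degree G u \<le> degree G v"
    "HSO_weight G {x, y} = sqrt (1 + (real (degree G v) / real (degree G u))\<^sup>2)"
    using edge_weightE[OF assms(1,2)] by metis
  then have "(real (degree G v) / real (degree G u))\<^sup>2 = 1\<^sup>2" using assms(3) by simp
  then have "real (degree G v) / real (degree G u) = 1"
    by (subst (asm) power2_eq_iff_nonneg) auto
  then have "degree G v = degree G u" using *(2) by simp
  then show ?thesis using *(1) by (auto simp: doubleton_eq_iff)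
qed

lemma edge_weight_le:
  assumes "simple_graph G" "e \<in> edges G"
    and "1 \<le> m" "\<And>v. v \<in> e \<Longrightarrow> m \<le> degree G v" "\<And>v. v \<in> e \<Longrightarrow> degree G v \<le> D"
  shows "HSO_weight G e \<le> sqrt (1 + (real D / real m)\<^sup>2)"
proof -
  obtain u v where *: "e = {u, v}" "1 \<le> degree G u" "degree G u \<le> degree G v"
    "HSO_weight G e = sqrt (1 + (real (degree G v) / real (degree G u))\<^sup>2)"
    using edge_weightE[OF assms(1,2)] .
  have "real (degree G v) / real (degree G u) \<le> real D / real m"
    by (rule frac_le) (use assms * in auto)
  then have "(real (degree G v) / real (degree G u))\<^sup>2 \<le> (real D / real m)\<^sup>2"
    by (rule power_mono) simp
  then show ?thesis using * by simp
qed

section \<open>Two-regular connected graphs\<close>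

lemma cycle_graph_simple:
  assumes "3 \<le> n"
  shows "simple_graph (cycle_graph n)"
proof -
  have "i \<noteq> (i + 1) mod n" if "i < n" for i
    using that assms by (cases "i + 1 = n") auto
  then show ?thesis using assms by (auto simp: simple_graph_def cycle_graph_def)
qed

lemma nbrs_cycle_graph:
  assumes n: "3 \<le> n" and i: "i < n"
  shows "nbrs (cycle_graph n) i = {(i + 1) mod n, (if i = 0 then n - 1 else i - 1)}"
proof -
  have pred: "j < n \<and> i = (j + 1) mod n \<longleftrightarrow> j = (if i = 0 then n - 1 else i - 1)" for j
  proof (cases "j + 1 < n")
    case True
    then show ?thesis using i by auto
  next
    case False
    then show ?thesis using n i by (cases "j + 1 = n") auto
  qed
  have "nbrs (cycle_graph n) i = {u. \<exists>j<n. {i, u} = {j, (j + 1) mod n}}"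
    by (auto simp: nbrs_def cycle_graph_def)
  also have "\<dots> = {u. u = (i + 1) mod n \<or> u < n \<and> i = (u + 1) mod n}"
    using i n by (auto simp: doubleton_eq_iff)
  also have "\<dots> = {(i + 1) mod n, (if i = 0 then n - 1 else i - 1)}"
    unfolding pred by auto
  finally show ?thesis .
qed

lemma degree_cycle_graph:
  assumes "3 \<le> n" "i < n"
  shows "degree (cycle_graph n) i = 2"
proof -
  have "(i + 1) mod n \<noteq> (if i = 0 then n - 1 else i - 1)"
    using assms by (cases "i + 1 = n") auto
  then show ?thesis
    using assms by (simp add: degree_eq_card_nbrs cycle_graph_simple nbrs_cycle_graph del: One_nat_def)
qed

lemma HSO_cycle_graph:
  assumes n: "3 \<le> n"
  shows "HSO (cycle_graph n) = sqrt 2 * real n"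
proof -
  let ?C = "cycle_graph n"
  note sg = cycle_graph_simple[OF n]
  have vC: "verts ?C = {..<n}" by (simp add: cycle_graph_def)
  have "2 * card (edges ?C) = (\<Sum>i\<in>verts ?C. degree ?C i)" by (simp add: handshake sg)
  also have "\<dots> = (\<Sum>i\<in>{..<n}. 2)"
    by (rule sum.cong) (use n in \<open>auto simp: vC degree_cycle_graph\<close>)
  finally have c: "card (edges ?C) = n" by simp
  have "HSO_weight ?C e = sqrt 2" if e: "e \<in> edges ?C" for e
  proof (rule antisym)
    have d: "degree ?C v = 2" if "v \<in> e" for v
      using sg e that n degree_cycle_graph by (auto simp: simple_graph_def cycle_graph_def)
    show "HSO_weight ?C e \<le> sqrt 2" using edge_weight_le[OF sg e, of 2 2] d by simp
  qed (rule edge_weight_ge[OF sg e])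
  then show ?thesis using c by (simp add: HSO_def)
qed

text \<open>Number the vertices along a longest path. Its last vertex has a second neighbour, which lies on
  the path by maximality, and which must be the first vertex because inner path vertices already
  have both of their neighbours on the path. The closed path contains all neighbours of its own
  vertices, so by connectedness it is the whole graph.\<close>

lemma connected_two_regular_is_cycle:
  assumes G: "simple_graph G" "connected_graph G"
    and reg: "\<And>v. v \<in> verts G \<Longrightarrow> degree G v = 2"
  shows "G \<cong>\<^sub>G cycle_graph (card (verts G))"
proof -
  define path where "path N w \<longleftrightarrow> inj_on w {..<N} \<and> w ` {..<N} \<subseteq> verts G
    \<and> (\<forall>i. Suc i < N \<longrightarrow> {w i, w (Suc i)} \<in> edges G)" for N :: nat and w
  have fin: "finite (verts G)" using G by (simp add: simple_graph_def)
  have bound: "N \<le> card (verts G)" if "path N w" for N w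
    using that card_inj_on_le[of w "{..<N}" "verts G"] fin by (auto simp: path_def)
  obtain v where v: "v \<in> verts G" using G by (auto simp: connected_graph_def)
  have "card (nbrs G v) = 2" using reg v G by (simp add: degree_eq_card_nbrs)
  then obtain a b where ab: "nbrs G v = {a, b}" "a \<noteq> b" by (auto simp: card_2_iff)
  then have e: "{v, a} \<in> edges G" "{v, b} \<in> edges G" by (auto simp: nbrs_def)
  \<comment> \<open>A path on three vertices; starting the maximisation here gives \<open>3 \<le> N\<close>.\<close>
  define w0 where "w0 = (\<lambda>i::nat. if i = 0 then a else if i = 1 then v else b)"
  have l3: "{..<3::nat} = {0, 1, 2}" by auto
  have "path 3 w0"
    unfolding path_def l3 w0_def
    using e ab edge_ends[OF G(1) e(1)] edge_ends[OF G(1) e(2)]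
    by (auto simp: insert_commute less_Suc_eq numeral_3_eq_3)
  then have ex: "\<exists>w. path 3 w" by blast
  define N where "N = (GREATEST N. \<exists>w. path N w)"
  have "\<exists>w. path N w" unfolding N_def
    by (rule GreatestI_nat[of _ 3 "card (verts G)"]) (use ex bound in auto)
  then obtain w where w: "path N w" by blast
  have max: "M \<le> N" if "path M u" for M u unfolding N_def
    by (rule Greatest_le_nat[of _ _ "card (verts G)"]) (use that bound in auto)
  have N3: "3 \<le> N" using ex max by blast
  have inj: "inj_on w {..<N}" and wV: "\<And>i. i < N \<Longrightarrow> w i \<in> verts G"
    and wE: "\<And>i. Suc i < N \<Longrightarrow> {w i, w (Suc i)} \<in> edges G"
    using w by (auto simp: path_def)
  have weq: "w i = w j \<longleftrightarrow> i = j" if "i < N" "j < N" for i j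
    using inj that by (auto simp: inj_on_def)
  have nb: "nbrs G (w i) = {x, y}"
    if "i < N" "x \<in> nbrs G (w i)" "y \<in> nbrs G (w i)" "x \<noteq> y" for i x y
  proof -
    have "card (nbrs G (w i)) = 2" using reg wV that G by (simp add: degree_eq_card_nbrs)
    then show ?thesis
      using that card_subset_eq[of "nbrs G (w i)" "{x, y}"] finite_nbrs[OF G(1)] by auto
  qed
  have inner: "nbrs G (w i) = {w (i + 1), w (i - 1)}" if "0 < i" "i + 1 < N" for i
    by (rule nb) (use that wE[of i] wE[of "i - 1"] weq in
        \<open>auto simp: nbrs_def insert_commute\<close>)
  have closing: "{w (N - 1), w 0} \<in> edges G"
  proof -
    have "card (nbrs G (w (N - 1))) = 2" using reg wV N3 G by (simp add: degree_eq_card_nbrs)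
    then have "nbrs G (w (N - 1)) - {w (N - 2)} \<noteq> {}"
      by (metis Diff_eq_empty_iff card.empty card_insert_disjoint card_mono empty_iff
          finite.emptyI finite.insertI numeral_2_eq_2 Suc_n_not_le_n)
    then obtain y where y: "y \<in> nbrs G (w (N - 1))" "y \<noteq> w (N - 2)" by auto
    have ye: "{w (N - 1), y} \<in> edges G" using y by (simp add: nbrs_def)
    \<comment> \<open>Otherwise appending \<open>y\<close> would give a longer path.\<close>
    have "y \<in> w ` {..<N}"
    proof (rule ccontr)
      assume n: "y \<notin> w ` {..<N}"
      have "path (Suc N) (w(N := y))"
        unfolding path_def
      proof (intro conjI allI impI)
        show "inj_on (w(N := y)) {..<Suc N}"
          using inj n by (auto simp: inj_on_def lessThan_Suc)
        show "(w(N := y)) ` {..<Suc N} \<subseteq> verts G"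
          using wV edge_ends[OF G(1) ye] by (auto simp: less_Suc_eq)
        fix i assume "Suc i < Suc N"
        then show "{(w(N := y)) i, (w(N := y)) (Suc i)} \<in> edges G"
          using wE[of i] ye by (cases "Suc i = N") auto
      qed
      then show False using max by fastforce
    qed
    then obtain j where j: "j < N" "y = w j" by auto
    \<comment> \<open>An inner vertex would have the last vertex as a third neighbour.\<close>
    have "j = 0"
    proof (rule ccontr)
      assume "j \<noteq> 0"
      have "j \<noteq> N - 1" using edge_ends(1)[OF G(1) ye] j by auto
      moreover have "j \<noteq> N - 2" using y j by auto
      ultimately have jj: "0 < j" "j + 2 < N" using \<open>j \<noteq> 0\<close> j by auto
      have "w (N - 1) \<in> nbrs G (w j)" using ye j by (simp add: nbrs_def insert_commute)
      then have "w (N - 1) = w (j + 1) \<or> w (N - 1) = w (j - 1)" using inner[of j] jj by auto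
      then show False using weq jj by auto
    qed
    then show ?thesis using ye j by simp
  qed
  have nbw: "nbrs G (w i) = w ` nbrs (cycle_graph N) i" if i: "i < N" for i
  proof -
    consider "i = 0" | "0 < i" "i + 1 < N" | "0 < i" "i = N - 1" using i by linarith
    then show ?thesis
    proof cases
      case 1
      have "nbrs G (w 0) = {w 1, w (N - 1)}"
        by (rule nb) (use N3 wE[of 0] closing weq in \<open>auto simp: nbrs_def insert_commute\<close>)
      then show ?thesis using 1 N3 by (simp add: nbrs_cycle_graph)
    next
      case 2
      then show ?thesis using inner N3 by (simp add: nbrs_cycle_graph)
    next
      case 3
      have "Suc (N - 2) = N - 1" using N3 by simp
      then have "nbrs G (w (N - 1)) = {w 0, w (N - 2)}"
        by (intro nb) (use N3 wE[of "N - 2"] closing weq in \<open>auto simp: nbrs_def insert_commute\<close>)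
      moreover have "i - 1 = N - 2" "(i + 1) mod N = 0" using 3 N3 by auto
      ultimately show ?thesis using 3 N3 i by (simp add: nbrs_cycle_graph)
    qed
  qed
  have sgC: "simple_graph (cycle_graph N)" by (rule cycle_graph_simple[OF N3])
  have vC: "verts (cycle_graph N) = {..<N}" by (simp add: cycle_graph_def)
  have onto: "w ` {..<N} = verts G"
  proof
    show "verts G \<subseteq> w ` {..<N}"
    proof
      fix x assume x: "x \<in> verts G"
      show "x \<in> w ` {..<N}"
      proof (rule connected_induct[OF G(2) wV[of 0] x])
        fix x y assume "x \<in> w ` {..<N}" "{x, y} \<in> edges G"
        then obtain i where "i < N" "y \<in> nbrs G (w i)" by (auto simp: nbrs_def)
        then show "y \<in> w ` {..<N}" using nbw nbrs_subset[OF sgC, of i] vC by auto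
      qed (use N3 in auto)
    qed
  qed (use wV in auto)
  then have Nn: "N = card (verts G)" using card_image[OF inj] by simp
  have "edges G = (`) w ` edges (cycle_graph N)"
  proof (intro equalityI subsetI)
    fix e assume e: "e \<in> edges G"
    then obtain x y where xy: "e = {x, y}" "x \<in> verts G" by (meson G(1) edgeE)
    then obtain i where i: "i < N" "x = w i" using onto by auto
    then have "y \<in> w ` nbrs (cycle_graph N) i" using nbw e xy by (auto simp: nbrs_def)
    then obtain j where "{i, j} \<in> edges (cycle_graph N)" "e = w ` {i, j}"
      using xy i by (auto simp: nbrs_def)
    then show "e \<in> (`) w ` edges (cycle_graph N)" by blast
  next
    fix e assume "e \<in> (`) w ` edges (cycle_graph N)"
    then obtain d where d: "d \<in> edges (cycle_graph N)" "e = w ` d" by auto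
    then obtain i j where ij: "d = {i, j}" "i \<in> verts (cycle_graph N)" by (meson sgC edgeE)
    then have "w j \<in> nbrs G (w i)" using nbw vC d by (auto simp: nbrs_def)
    then show "e \<in> edges G" using d ij by (simp add: nbrs_def)
  qed
  then have "G \<cong>\<^sub>G cycle_graph N"
    by (intro graph_isoI[where w = w] sgC) (use onto inj vC in \<open>auto simp: bij_betw_def\<close>)
  then show "G \<cong>\<^sub>G cycle_graph (card (verts G))" using Nn by simp
qed

section \<open>Unicyclic graphs with a dominating vertex\<close>

text \<open>A star with one further edge: the form in which the graph arises from a vertex of degree
  \<open>n - 1\<close>.\<close>

lemma edges_S':
  assumes "3 \<le> n"
  shows "edges (S'_graph n) = insert {1, 2} ((\<lambda>i. {0, i}) ` {1..<n})"
proof -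
  have "{1..<n} = insert 1 (insert 2 {3..<n})" using assms by auto
  moreover have "{{0, i} |i. 3 \<le> i \<and> i < n} = (\<lambda>i. {0, i}) ` {3..<n}" by auto
  ultimately show ?thesis unfolding S'_graph_def by auto
qed

lemma S'_simple:
  assumes "3 \<le> n"
  shows "simple_graph (S'_graph n)"
proof -
  have "verts (S'_graph n) = {..<n}" by (simp add: S'_graph_def)
  then show ?thesis using assms by (auto simp: simple_graph_def edges_S')
qed

lemma degree_S':
  assumes n: "3 \<le> n"
  shows "degree (S'_graph n) 0 = n - 1" "degree (S'_graph n) 1 = 2" "degree (S'_graph n) 2 = 2"
    "\<And>i. 3 \<le> i \<Longrightarrow> i < n \<Longrightarrow> degree (S'_graph n) i = 1"
proof -
  have "nbrs (S'_graph n) 0 = {1..<n}" "nbrs (S'_graph n) 1 = {0, 2}" "nbrs (S'_graph n) 2 = {0, 1}"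
    "\<And>i. 3 \<le> i \<Longrightarrow> i < n \<Longrightarrow> nbrs (S'_graph n) i = {0}"
    using n by (auto simp: nbrs_def edges_S' doubleton_eq_iff)
  then show "degree (S'_graph n) 0 = n - 1" "degree (S'_graph n) 1 = 2" "degree (S'_graph n) 2 = 2"
    "\<And>i. 3 \<le> i \<Longrightarrow> i < n \<Longrightarrow> degree (S'_graph n) i = 1"
    using S'_simple[OF n] by (simp_all add: degree_eq_card_nbrs)
qed

lemma HSO_S':
  assumes n: "3 \<le> n"
  shows "HSO (S'_graph n) = (real n - 3) * sqrt ((real n)\<^sup>2 - 2 * real n + 2)
           + sqrt ((real n)\<^sup>2 - 2 * real n + 5) + sqrt 2"
proof -
  let ?S = "S'_graph n"
  note deg = degree_S'[OF n]
  have real1: "real (n - 1) = real n - 1" using n by simp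
  have "{1, 2} \<notin> (\<lambda>i. {0, i}) ` {1..<n}" by (auto simp: doubleton_eq_iff)
  moreover have "inj_on (\<lambda>i. {0, i}) {1..<n}" by (auto simp: inj_on_def doubleton_eq_iff)
  ultimately have "HSO ?S = HSO_weight ?S {1, 2} + (\<Sum>i\<in>{1..<n}. HSO_weight ?S {0, i})"
    by (simp add: HSO_def edges_S' n sum.reindex del: One_nat_def)
  also have "{1..<n} = insert 1 (insert 2 {3..<n})" using n by auto
  also have "(\<Sum>i\<in>insert 1 (insert 2 {3..<n}). HSO_weight ?S {0, i}) =
     HSO_weight ?S {0, 1} + HSO_weight ?S {0, 2} + (\<Sum>i\<in>{3..<n}. HSO_weight ?S {0, i})"
    by simp
  also have "(\<Sum>i\<in>{3..<n}. HSO_weight ?S {0, i}) = (real n - 3) * sqrt ((real n)\<^sup>2 - 2 * real n + 2)"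
  proof -
    have "HSO_weight ?S {0, i} = sqrt ((real n)\<^sup>2 - 2 * real n + 2)" if "i \<in> {3..<n}" for i
    proof -
      have "degree ?S i = 1" "0 \<noteq> i" "min (n - 1) 1 = 1" using that deg(4) by auto
      moreover have "(real n - 1)\<^sup>2 + 1 = (real n)\<^sup>2 - 2 * real n + 2"
        by (simp add: power2_eq_square algebra_simps)
      ultimately show ?thesis
        by (simp add: HSO_weight_pair deg(1) real1 del: One_nat_def)
    qed
    then show ?thesis using n by (simp add: of_nat_diff)
  qed
  also have "HSO_weight ?S {1, 2} = sqrt 2"
  proof -
    have "sqrt (2\<^sup>2 + 2\<^sup>2) = sqrt (2\<^sup>2 * 2)" by simp
    also have "\<dots> = 2 * sqrt 2" by (simp only: real_sqrt_mult) simp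
    finally show ?thesis using HSO_weight_pair[of 1 2 ?S] deg(2,3) by simp
  qed
  also have "HSO_weight ?S {0, 1} + HSO_weight ?S {0, 2} = sqrt ((real n)\<^sup>2 - 2 * real n + 5)"
  proof -
    have "sqrt ((real n - 1)\<^sup>2 + 4) = sqrt ((real n)\<^sup>2 - 2 * real n + 5)"
      by (simp add: power2_eq_square algebra_simps)
    moreover have "min (n - 1) 2 = 2" using n by simp
    ultimately show ?thesis
      using HSO_weight_pair[of 0 1 ?S] HSO_weight_pair[of 0 2 ?S] deg(1,2,3) real1
      by (simp add: add.commute)
  qed
  finally show ?thesis by simp
qed

text \<open>The dominating vertex is joined to all others, which accounts for \<open>n - 1\<close> edges. The remaining
  edge avoids it, so its ends may be numbered 1 and 2; the numbering of the other vertices is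
  arbitrary.\<close>

lemma dominating_vertex_is_S':
  assumes G: "simple_graph G" and nV: "card (verts G) = n" and nE: "card (edges G) = n"
    and n: "3 \<le> n" and v: "v \<in> verts G" "degree G v = n - 1"
  shows "G \<cong>\<^sub>G S'_graph n"
proof -
  have fin: "finite (verts G)" using G by (simp add: simple_graph_def)
  have nb: "nbrs G v = verts G - {v}"
    by (rule card_subset_eq)
      (use G v fin nV in \<open>auto simp: degree_eq_card_nbrs dest: nbrs_subset\<close>)
  define F where "F = {e \<in> edges G. v \<in> e}"
  have F: "F = (\<lambda>u. {v, u}) ` (verts G - {v})"
    unfolding F_def using incident_edges[OF G, of v] nb by simp
  have "card (edges G - F) = 1"
  proof -
    have "card F = n - 1" using v by (simp add: F_def degree_def)
    moreover have "F \<subseteq> edges G" "finite (edges G)" using finite_edges[OF G] by (auto simp: F_def)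
    ultimately show ?thesis using n nE by (simp add: card_Diff_subset finite_subset)
  qed
  then obtain e where e: "edges G - F = {e}" by (auto simp: card_1_singleton_iff)
  then have "e \<in> edges G" by auto
  then obtain a b where ab: "e = {a, b}" "a \<noteq> b" "a \<in> verts G" "b \<in> verts G"
    by (meson G edgeE)
  have vab: "v \<noteq> a" "v \<noteq> b" using e ab by (auto simp: F_def)
  have E: "edges G = insert {a, b} ((\<lambda>u. {v, u}) ` (verts G - {v}))"
    using e ab F by (auto simp: F_def)
  have "card (verts G - {v, a, b}) = n - 3"
    using fin vab ab v nV by (subst card_Diff_subset) auto
  then obtain g where g: "bij_betw g {3..<n} (verts G - {v, a, b})"
    using finite_same_card_bij[of "{3..<n}" "verts G - {v, a, b}"] fin by auto
  define w where "w = g(0 := v, 1 := a, 2 := b)"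
  have w012: "w 0 = v" "w 1 = a" "w 2 = b" by (auto simp: w_def)
  have w3: "bij_betw w {3..<n} (verts G - {v, a, b})"
    using g by (rule bij_betw_cong[THEN iffD1, rotated]) (auto simp: w_def)
  have "bij_betw w ({1, 2} \<union> {3..<n}) ({a, b} \<union> (verts G - {v, a, b}))"
    by (rule bij_betw_combine[OF _ w3]) (use w012 ab in \<open>auto simp: bij_betw_def\<close>)
  moreover have "{1, 2} \<union> {3..<n} = {1..<n}" using n by auto
  moreover have "{a, b} \<union> (verts G - {v, a, b}) = verts G - {v}" using ab vab by auto
  ultimately have w1: "bij_betw w {1..<n} (verts G - {v})" by metis
  have "bij_betw w ({0} \<union> {1..<n}) ({v} \<union> (verts G - {v}))"
    by (rule bij_betw_combine[OF _ w1]) (use w012 in \<open>auto simp: bij_betw_def\<close>)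
  moreover have "{0} \<union> {1..<n} = {..<n}" using n by auto
  moreover have "{v} \<union> (verts G - {v}) = verts G" using v by auto
  ultimately have wb: "bij_betw w {..<n} (verts G)" by metis
  have "(`) w ` edges (S'_graph n) = insert {a, b} ((\<lambda>u. {v, u}) ` w ` {1..<n})"
    using w012 by (simp add: edges_S' n image_image del: One_nat_def)
  also have "w ` {1..<n} = verts G - {v}" using w1 by (simp add: bij_betw_def)
  finally have "edges G = (`) w ` edges (S'_graph n)" using E by simp
  moreover have "verts (S'_graph n) = {..<n}" by (simp add: S'_graph_def)
  ultimately show ?thesis using graph_isoI[OF S'_simple[OF n]] wb by metis
qed

section \<open>Unicyclic graphs without a dominating vertex\<close>

text \<open>Let \<open>C\<close> be the set of vertices of degree at least 2. Each of the other vertices accounts for at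
  most one edge, so at least \<open>card C\<close> of the \<open>n\<close> edges have both ends in \<open>C\<close>. Then
  \<open>card C \<le> card C choose 2\<close>, which leaves only \<open>card C = 0\<close> or \<open>card C \<ge> 3\<close>, and the former
  contradicts the average degree 2.\<close>

lemma three_non_pendent_edges:
  assumes G: "simple_graph G" and nV: "card (verts G) = n" and nE: "card (edges G) = n"
    and n0: "0 < n"
  shows "3 \<le> card {e \<in> edges G. \<forall>v\<in>e. 2 \<le> degree G v}"
proof -
  define P where "P = {v \<in> verts G. degree G v \<le> 1}"
  define C where "C = {v \<in> verts G. 2 \<le> degree G v}"
  define E2 where "E2 = {e \<in> edges G. \<forall>v\<in>e. 2 \<le> degree G v}"
  have fin: "finite (verts G)" "finite (edges G)" using G finite_edges by (auto simp: simple_graph_def)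
  have finP: "finite P" "finite C" "finite E2" using fin by (auto simp: P_def C_def E2_def)
  have "verts G = P \<union> C" "P \<inter> C = {}" by (auto simp: P_def C_def)
  then have pc: "card P + card C = n" using nV finP card_Un_disjoint by metis
  have "card (edges G - E2) \<le> card (\<Union>v\<in>P. {e \<in> edges G. v \<in> e})"
  proof (rule card_mono)
    show "edges G - E2 \<subseteq> (\<Union>v\<in>P. {e \<in> edges G. v \<in> e})"
      using G by (fastforce simp: E2_def P_def simple_graph_def)
  qed (use fin finP in auto)
  also have "\<dots> \<le> (\<Sum>v\<in>P. card {e \<in> edges G. v \<in> e})" by (rule card_UN_le[OF finP(1)])
  also have "\<dots> \<le> (\<Sum>v\<in>P. 1)" by (rule sum_mono) (simp add: P_def degree_def)
  finally have "card (edges G - E2) \<le> card P" by simp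
  moreover have "card (edges G - E2) = n - card E2" "card E2 \<le> n"
    using finP fin nE by (auto simp: E2_def card_Diff_subset intro: card_mono)
  ultimately have q: "card C \<le> card E2" using pc by linarith
  have "C \<noteq> {}"
  proof
    assume "C = {}"
    then have "\<And>v. v \<in> verts G \<Longrightarrow> degree G v \<le> 1" by (force simp: C_def)
    then have "(\<Sum>v\<in>verts G. degree G v) \<le> (\<Sum>v\<in>verts G. 1)" by (intro sum_mono) auto
    then show False using handshake[OF G] nV nE n0 by simp
  qed
  then have c0: "0 < card C" using finP by (simp add: card_gt_0_iff)
  have "card E2 \<le> card {e. e \<subseteq> C \<and> card e = 2}"
    by (rule card_mono) (use G finP in \<open>auto simp: E2_def C_def simple_graph_def\<close>)
  then have "card C \<le> card C choose 2" using q n_subsets[OF finP(2), of 2] by simp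
  then have "card C * 2 \<le> card C * (card C - 1)"
    unfolding choose_two by linarith
  then have "3 \<le> card C" using c0 by simp
  then show ?thesis using q by (simp add: E2_def)
qed

text \<open>The strict comparison of the two bounds, with \<open>t = n - 2\<close>. Since \<open>f x = sqrt (1 + x\<^sup>2)\<close> has
  slope close to 1, raising the argument from \<open>t\<close> to \<open>t + 1\<close> gains at least \<open>1 / 2\<close> in each of the
  \<open>t - 1\<close> terms. Of the three terms \<open>f (t / 2)\<close>, two increase as well and the third, at most
  \<open>(t + 1) / 2\<close>, is replaced by \<open>sqrt 2\<close>; the gain makes up for that because
  \<open>(t - 1) / 2 + sqrt 2 > (t + 1) / 2\<close>.\<close>

lemma sqrt_gap:
  fixes t :: real
  assumes t: "2 \<le> t"
  shows "(t - 1) * sqrt (1 + t\<^sup>2) + 3 * sqrt (1 + (t / 2)\<^sup>2)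
    < (t - 1) * sqrt (1 + (t + 1)\<^sup>2) + 2 * sqrt (1 + ((t + 1) / 2)\<^sup>2) + sqrt 2"
proof -
  let ?f = "\<lambda>x. sqrt (1 + x\<^sup>2)"
  have f1: "?f t \<le> t + 1" by (rule real_le_lsqrt) (use t in \<open>auto simp: power2_eq_square algebra_simps\<close>)
  have "?f t + 1 / 2 \<le> ?f (t + 1)"
  proof (rule real_le_rsqrt)
    have "(?f t + 1 / 2)\<^sup>2 = 1 + t\<^sup>2 + ?f t + 1 / 4"
      by (simp add: power2_sum power_divide)
    also have "\<dots> \<le> 1 + (t + 1)\<^sup>2" using f1 t by (simp add: power2_eq_square algebra_simps)
    finally show "(?f t + 1 / 2)\<^sup>2 \<le> 1 + (t + 1)\<^sup>2" .
  qed
  then have "(t - 1) * (?f t + 1 / 2) \<le> (t - 1) * ?f (t + 1)"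
    using t by (intro mult_left_mono) auto
  then have "(t - 1) * ?f t + (t - 1) / 2 \<le> (t - 1) * ?f (t + 1)"
    by (simp add: distrib_left)
  moreover have "?f (t / 2) \<le> t / 2 + 1 / 2"
    by (rule real_le_lsqrt) (use t in \<open>auto simp: power2_eq_square algebra_simps\<close>)
  moreover have "?f (t / 2) \<le> ?f ((t + 1) / 2)"
    using t by (simp only: real_sqrt_le_iff add_le_cancel_left) (intro power_mono; simp)
  moreover have "1 < sqrt (2 :: real)" by simp
  moreover have "a + 3 * c < b + 2 * d + s"
    if "a + (t - 1) / 2 \<le> b" "c \<le> t / 2 + 1 / 2" "c \<le> d" "1 < s" for a b c d s :: real
    using that by (simp add: field_simps)
  ultimately show ?thesis by blast
qed

lemma HSO_less_without_dominating_vertex: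
  assumes G: "simple_graph G" and nV: "card (verts G) = n" and nE: "card (edges G) = n"
    and n: "3 \<le> n" and small: "\<And>v. v \<in> verts G \<Longrightarrow> degree G v \<le> n - 2"
  shows "HSO G < (real n - 3) * sqrt ((real n)\<^sup>2 - 2 * real n + 2)
           + sqrt ((real n)\<^sup>2 - 2 * real n + 5) + sqrt 2"
proof -
  let ?f = "\<lambda>x. sqrt (1 + x\<^sup>2)"
  define t where "t = real n - 2"
  have t': "real (n - 2) = t" using n by (simp add: t_def of_nat_diff)
  \<comment> \<open>The average degree is 2, so degrees bounded by \<open>n - 2\<close> force \<open>n \<ge> 4\<close>.\<close>
  have "2 * n \<le> n * (n - 2)"
  proof -
    have "(\<Sum>v\<in>verts G. degree G v) \<le> (\<Sum>v\<in>verts G. n - 2)" by (rule sum_mono) (rule small)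
    then show ?thesis using handshake[OF G] nV nE by simp
  qed
  then have "2 \<le> n - 2" using n by simp
  then have t: "2 \<le> t" using t' by (metis of_nat_le_iff of_nat_numeral)
  define E2 where "E2 = {e \<in> edges G. \<forall>v\<in>e. 2 \<le> degree G v}"
  define q where "q = real (card E2)"
  have q3: "3 \<le> q" using three_non_pendent_edges[OF G nV nE] n by (simp add: q_def E2_def)
  have fin: "finite (edges G)" by (rule finite_edges[OF G])
  have sub: "E2 \<subseteq> edges G" by (auto simp: E2_def)
  have sm: "\<And>e v. e \<in> edges G \<Longrightarrow> v \<in> e \<Longrightarrow> degree G v \<le> n - 2"
    using small G by (auto simp: simple_graph_def)
  have w2: "HSO_weight G e \<le> ?f (t / 2)" if "e \<in> E2" for e
    using edge_weight_le[OF G, of e 2 "n - 2"] that sm t' by (simp add: E2_def)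
  have w1: "HSO_weight G e \<le> ?f t" if "e \<in> edges G" for e
    using edge_weight_le[OF G that, of 1 "n - 2"] degree_pos[OF G that] sm[OF that] t' by simp
  have c: "real (card (edges G - E2)) = real n - q"
    using sub fin nE card_mono[OF fin sub] by (simp add: q_def card_Diff_subset finite_subset of_nat_diff)
  have "HSO G = (\<Sum>e\<in>edges G - E2. HSO_weight G e) + (\<Sum>e\<in>E2. HSO_weight G e)"
    unfolding HSO_def by (rule sum.subset_diff[OF sub fin])
  also have "\<dots> \<le> (\<Sum>e\<in>edges G - E2. ?f t) + (\<Sum>e\<in>E2. ?f (t / 2))"
    by (intro add_mono sum_mono w1 w2) auto
  also have "\<dots> = (real n - q) * ?f t + q * ?f (t / 2)" by (simp add: c q_def)
  \<comment> \<open>Fewer edges of the lighter kind only increase the bound, so three is the worst case.\<close>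
  also have "\<dots> \<le> (t - 1) * ?f t + 3 * ?f (t / 2)"
  proof -
    have "(t / 2)\<^sup>2 \<le> t\<^sup>2" using t by (intro power_mono) auto
    then have "?f (t / 2) \<le> ?f t" by simp
    then have "(q - 3) * ?f (t / 2) \<le> (q - 3) * ?f t" using q3 by (intro mult_left_mono) auto
    then show ?thesis by (simp add: t_def algebra_simps)
  qed
  also have "\<dots> < (t - 1) * ?f (t + 1) + 2 * ?f ((t + 1) / 2) + sqrt 2" by (rule sqrt_gap[OF t])
  also have "2 * ?f ((t + 1) / 2) = sqrt ((real n)\<^sup>2 - 2 * real n + 5)"
  proof -
    have "2 * ?f ((t + 1) / 2) = sqrt (2\<^sup>2) * ?f ((t + 1) / 2)" by simp
    also have "\<dots> = sqrt (2\<^sup>2 * (1 + ((t + 1) / 2)\<^sup>2))" by (simp only: real_sqrt_mult)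
    also have "2\<^sup>2 * (1 + ((t + 1) / 2)\<^sup>2) = (real n)\<^sup>2 - 2 * real n + 5"
      by (simp add: t_def power2_eq_square field_simps)
    finally show ?thesis .
  qed
  also have "1 + (t + 1)\<^sup>2 = (real n)\<^sup>2 - 2 * real n + 2"
    by (simp add: t_def power2_eq_square algebra_simps)
  also have "t - 1 = real n - 3" by (simp add: t_def)
  finally show ?thesis .
qed

section \<open>The extremal unicyclic graphs\<close>

lemma HSO_lower_bound:
  assumes "simple_graph G"
  shows "sqrt 2 * real (card (edges G)) \<le> HSO G"
  unfolding HSO_def using sum_bounded_below[of "edges G" "sqrt 2" "HSO_weight G"] edge_weight_ge[OF assms]
  by (simp add: mult.commute)

lemma HSO_minimal_imp_regular:
  assumes G: "simple_graph G" "connected_graph G"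
    and eq: "HSO G = sqrt 2 * real (card (edges G))"
    and uv: "u \<in> verts G" "v \<in> verts G"
  shows "degree G u = degree G v"
proof -
  have "(\<Sum>e\<in>edges G. HSO_weight G e) = (\<Sum>e\<in>edges G. sqrt 2)"
    using eq by (simp add: HSO_def mult.commute)
  then have "HSO_weight G e = sqrt 2" if "e \<in> edges G" for e
    using sum_mono_inv[of "\<lambda>_. sqrt 2" "edges G" "HSO_weight G" e] that
      edge_weight_ge[OF G(1)] finite_edges[OF G(1)] by simp
  then have "degree G x = degree G y" if "{x, y} \<in> edges G" for x y
    using edge_weight_eq_sqrt2[OF G(1)] that by blast
  then show ?thesis
    by (intro connected_induct[OF G(2) uv, of "\<lambda>x. degree G u = degree G x"]) (rule refl, metis)
qed

theorem theorem3p2: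
  fixes G :: "'a ugraph" and n :: nat
  assumes "unicyclic G n"
  shows "sqrt 2 * real n \<le> HSO G
    \<and> HSO G \<le> (real n - 3) * sqrt ((real n)\<^sup>2 - 2 * real n + 2)
                + sqrt ((real n)\<^sup>2 - 2 * real n + 5) + sqrt 2
    \<and> (HSO G = sqrt 2 * real n \<longleftrightarrow> G \<cong>\<^sub>G cycle_graph n)
    \<and> (HSO G = (real n - 3) * sqrt ((real n)\<^sup>2 - 2 * real n + 2)
                + sqrt ((real n)\<^sup>2 - 2 * real n + 5) + sqrt 2
        \<longleftrightarrow> G \<cong>\<^sub>G S'_graph n)"
proof -
  let ?U = "(real n - 3) * sqrt ((real n)\<^sup>2 - 2 * real n + 2)
                + sqrt ((real n)\<^sup>2 - 2 * real n + 5) + sqrt 2"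
  have G: "simple_graph G" "connected_graph G" and nV: "card (verts G) = n"
    and nE: "card (edges G) = n"
    using assms by (auto simp: unicyclic_def)
  have fin: "finite (verts G)" using G by (simp add: simple_graph_def)
  obtain r where r: "r \<in> verts G" using G by (auto simp: connected_graph_def)
  then have n0: "0 < n" using nV fin by (auto simp: card_gt_0_iff)
  \<comment> \<open>The model graphs are simple, with the intended degrees, only from order 3 on.\<close>
  have n: "3 \<le> n"
  proof -
    have "card {e \<in> edges G. \<forall>v\<in>e. 2 \<le> degree G v} \<le> card (edges G)"
      by (rule card_mono) (use finite_edges[OF G(1)] in auto)
    then show ?thesis using three_non_pendent_edges[OF G(1) nV nE n0] nE by linarith
  qed
  have lower: "sqrt 2 * real n \<le> HSO G" using HSO_lower_bound[OF G(1)] nE by simp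
  have C1: "G \<cong>\<^sub>G cycle_graph n" if "HSO G = sqrt 2 * real n"
  proof -
    have d: "degree G v = degree G r" if "v \<in> verts G" for v
      using HSO_minimal_imp_regular[OF G _ that r] nE \<open>HSO G = sqrt 2 * real n\<close> by simp
    have "(\<Sum>v\<in>verts G. degree G v) = n * degree G r" using d nV by simp
    then have "degree G r = 2" using handshake[OF G(1)] nE n0 by simp
    then show ?thesis using connected_two_regular_is_cycle[OF G] d nV by simp
  qed
  have C2: "HSO G = sqrt 2 * real n" if "G \<cong>\<^sub>G cycle_graph n"
    using HSO_iso[OF G(1) cycle_graph_simple[OF n] that] HSO_cycle_graph[OF n] by simp
  have S2: "HSO G = ?U" if "G \<cong>\<^sub>G S'_graph n"
    using HSO_iso[OF G(1) S'_simple[OF n] that] HSO_S'[OF n] by simp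
  have "G \<cong>\<^sub>G S'_graph n \<or> HSO G < ?U"
  proof (cases "\<exists>v\<in>verts G. degree G v = n - 1")
    case True
    then show ?thesis using dominating_vertex_is_S'[OF G(1) nV nE n] by blast
  next
    case False
    have "degree G v \<le> n - 2" if "v \<in> verts G" for v
    proof -
      have "degree G v \<noteq> n - 1" using False that by blast
      then show ?thesis using degree_le[OF G(1) that] nV by linarith
    qed
    then show ?thesis using HSO_less_without_dominating_vertex[OF G(1) nV nE n] by blast
  qed
  then show ?thesis using lower C1 C2 S2 by (metis less_le order_refl)
qed

end
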